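(* Consider the multi-armed bandit protocol with $d$ arms. For a sequence of arms $f\in[d]^T$ let $K(f)=|\{t<T:f(t)\ne f(t+1)\}|$, and let $S(d,K(f),T)=K(f)\log(dT)+2\log(d)$. Let $\mathcal{A}$ be any full information algorithm with an expected approximate regret guarantee for shifting comparators of $\mathbb{E}[\mathrm{ApxReg}(f,\varepsilon/5)]\le\frac{5L\cdot S(d,K(f),T)}{\varepsilon}$ against any sequence of arms $f\in[d]^T$, when run on losses in $[0,L]$. Then for any $\delta>0$, the Double-Threshold Freezing Algorithm run with learning parameter $\varepsilon'=\varepsilon/5$ on input $\mathcal{A}$, $\alpha=d$, $d$, has, with probability $1-\delta$, $\varepsilon$-approximate regret for shifting comparators $f\in[d]^T$ of $$\mathrm{ApxReg}(f,\varepsilon)=O\!\left(\frac{d\cdot\big(S(d,K(f),T)+K(f)\log(dT/\delta)\big)}{\varepsilon^2}\right).$$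
   Context: **Multi-armed bandit protocol.** There are $d$ arms and $T$ rounds. In each round $t$ the learner picks a distribution $w^t$ on $[d]$; the adversary then picks $\ell^t\in[0,1]^d$ (possibly depending on the past, in particular on $I(1),\dots,I(t-1)$, but not on $I(t)$); the learner draws $I(t)\sim w^t$, and suffers and observes only $\ell^t_{I(t)}$. (This is graph feedback with the empty graph, whose independence number is $d$.) **Approximate regret with shifting comparators.** For $f=(f(1),\dots,f(T))\in[d]^T$, $\mathrm{ApxReg}(f,\varepsilon)=\sum_{t=1}^T\big[(1-\varepsilon)\ell^t_{I(t)}-\ell^t_{f(t)}\big]$. **Full information algorithm.** It outputs in each round a distribution $p^t$ on $[d]$ as a function of past full loss vectors; its expected approximate regret with parameter $\varepsilon$ on losses $\widetilde\ell^t$ is $\sum_t\big[(1-\varepsilon)\sum_ip_i^t\widetilde\ell_i^t-\widetilde\ell^t_{f(t)}\big]$. **Double-Threshold Freezing Algorithm** specialised to bandit feedback (each arm observes only itself; $\gamma=\frac{\varepsilon'}{4d}$, $\gamma'=\gamma/3$). In each round $t$, with $p^t$ given by $\mathcal{A}$: $F^t=\{i:p_i^t<\gamma\}$ (the further propagation step, which freezes non-frozen arms observed with probability below $\gamma'$, freezes nothing more); $w_i^t=0$ for $i\in F^t$ and $w_i^t=p_i^t/(1-\sum_{j\in F^t}p_j^t)$ otherwise; draw $I(t)\sim w^t$; $\widetilde\ell_i^t=\ell_i^t/w_i^t$ if $i=I(t)$ and $0$ otherwise; feed $\widetilde\ell^t$ to $\mathcal{A}$.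
   Formalization: For comparators with K(f)=0 the term K(f)·log(dT/δ), which vanishes, is replaced by log(1/δ), since a bound O(d log d/ε²) with probability 1−δ for every δ>0 is false; for K(f)≥1 the bound is unchanged. *)

theory Defs
  imports "HOL-Probability.Probability" "HOL-Library.Monad_Syntax"
begin

text \<open>
  The $d$ arms are the numbers \<open>0, \<dots>, d - 1\<close> and the $T$ rounds are \<open>0, \<dots>, T - 1\<close>.
  A loss vector is a function on \<open>nat\<close> that vanishes outside of the arms, so that it carries
  no information besides its $d$ coordinates.
\<close>

type_synonym loss_vec = "nat \<Rightarrow> real"

definition loss_vecs :: "nat \<Rightarrow> real \<Rightarrow> loss_vec set" where
  "loss_vecs d L = {l. (\<forall>i<d. 0 \<le> l i \<and> l i \<le> L) \<and> (\<forall>i\<ge>d. l i = 0)}"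

definition comparators :: "nat \<Rightarrow> nat \<Rightarrow> (nat \<Rightarrow> nat) set" where
  "comparators d T = {f. \<forall>t<T. f t < d}"

definition num_shifts :: "nat \<Rightarrow> (nat \<Rightarrow> nat) \<Rightarrow> nat" where
  "num_shifts T f = card {t. Suc t < T \<and> f t \<noteq> f (Suc t)}"

text \<open>A comparator without shifts still needs a confidence term: a regret bound
  $O(d \log d / \varepsilon^2)$ with probability $1 - \delta$ for every $\delta > 0$ fails. Hence in the
  final bound $\log(1/\delta)$ stands in for $K \log(dT/\delta)$ when $K = 0$.\<close>

definition shift_complexity :: "nat \<Rightarrow> nat \<Rightarrow> nat \<Rightarrow> real" where
  "shift_complexity d K T = real K * ln (real d * real T) + 2 * ln (real d)"


text \<open>A full information algorithm maps the list of past loss vectors, oldest first,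
  to its distribution on the arms.\<close>

type_synonym full_info_alg = "loss_vec list \<Rightarrow> nat pmf"

definition full_info_algorithm :: "nat \<Rightarrow> full_info_alg \<Rightarrow> bool" where
  "full_info_algorithm d A \<longleftrightarrow> (\<forall>ls. set_pmf (A ls) \<subseteq> {..<d})"

definition expected_apx_reg ::
  "full_info_alg \<Rightarrow> nat \<Rightarrow> nat \<Rightarrow> loss_vec list \<Rightarrow> (nat \<Rightarrow> nat) \<Rightarrow> real \<Rightarrow> real" where
  "expected_apx_reg A d T ls f e =
    (\<Sum>t<T. (1 - e) * (\<Sum>i<d. pmf (A (take t ls)) i * (ls ! t) i) - (ls ! t) (f t))"

text \<open>Since the algorithm is a deterministic map from losses to distributions, a guarantee on
  every fixed loss sequence also covers adaptively generated losses.\<close>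

definition shifting_guarantee ::
  "full_info_alg \<Rightarrow> nat \<Rightarrow> nat \<Rightarrow> real \<Rightarrow> real \<Rightarrow> bool" where
  "shifting_guarantee A d T L \<epsilon> \<longleftrightarrow>
    (\<forall>ls f. length ls = T \<longrightarrow> set ls \<subseteq> loss_vecs d L \<longrightarrow> f \<in> comparators d T \<longrightarrow>
       expected_apx_reg A d T ls f (\<epsilon> / 5)
         \<le> 5 * L * shift_complexity d (num_shifts T f) T / \<epsilon>)"


text \<open>The adversary chooses the next loss vector, possibly at random, from the past loss vectors
  and the past draws of the learner. The learner's current distribution is a
  function of the same data, so the adversary may depend on it as well.\<close>

type_synonym history = "(loss_vec \<times> nat) list"

type_synonym adversary = "history \<Rightarrow> loss_vec pmf"

definition bandit_adversary :: "nat \<Rightarrow> adversary \<Rightarrow> bool" where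
  "bandit_adversary d adv \<longleftrightarrow> (\<forall>h. set_pmf (adv h) \<subseteq> loss_vecs d 1)"

definition apx_reg :: "history \<Rightarrow> nat \<Rightarrow> (nat \<Rightarrow> nat) \<Rightarrow> real \<Rightarrow> real" where
  "apx_reg h T f \<epsilon> =
    (\<Sum>t<T. (1 - \<epsilon>) * fst (h ! t) (snd (h ! t)) - fst (h ! t) (f t))"


text \<open>An arm that is not frozen is played with probability at least this threshold, so the
  estimated losses that the freezing algorithm passes on lie between 0 and the inverse of the
  threshold.\<close>

definition freeze_threshold :: "nat \<Rightarrow> real \<Rightarrow> real" where
  "freeze_threshold d \<epsilon>' = \<epsilon>' / (4 * real d)"

definition frozen :: "real \<Rightarrow> nat pmf \<Rightarrow> nat set" where
  "frozen \<gamma> p = {i. pmf p i < \<gamma>}"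

text \<open>Zeroing the frozen arms and renormalising is conditioning on not being frozen; see
  \<open>pmf_play_distr\<close> and \<open>pmf_play_distr_threshold\<close> below for the explicit weights.\<close>

definition play_distr :: "real \<Rightarrow> nat pmf \<Rightarrow> nat pmf" where
  "play_distr \<gamma> p = cond_pmf p (- frozen \<gamma> p)"

definition loss_estimate :: "nat pmf \<Rightarrow> loss_vec \<Rightarrow> nat \<Rightarrow> loss_vec" where
  "loss_estimate w l I = (\<lambda>i. if i = I then l i / pmf w i else 0)"

text \<open>The joint law, after \<open>t\<close> rounds, of the history and of the estimated losses fed to \<open>A\<close>.
  The loss vector and the arm of a round are independent given the past.\<close>

primrec double_threshold_freezing ::
  "full_info_alg \<Rightarrow> nat \<Rightarrow> real \<Rightarrow> adversary \<Rightarrow> nat \<Rightarrow> (history \<times> loss_vec list) pmf" where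
  "double_threshold_freezing A d \<epsilon>' adv 0 = return_pmf ([], [])"
| "double_threshold_freezing A d \<epsilon>' adv (Suc t) =
    do {
      (h, es) \<leftarrow> double_threshold_freezing A d \<epsilon>' adv t;
      let w = play_distr (freeze_threshold d \<epsilon>') (A es);
      l \<leftarrow> adv h;
      I \<leftarrow> w;
      return_pmf (h @ [(l, I)], es @ [loss_estimate w l I])
    }"


lemma pmf_play_distr:
  assumes p: "set_pmf p \<subseteq> {..<d}" and unfrozen: "set_pmf p \<inter> - frozen \<gamma> p \<noteq> {}"
  shows "pmf (play_distr \<gamma> p) i =
    (if i \<in> frozen \<gamma> p then 0
     else pmf p i / (1 - (\<Sum>j \<in> frozen \<gamma> p \<inter> {..<d}. pmf p j)))"
proof -
  have "measure_pmf.prob p (- frozen \<gamma> p) = 1 - measure_pmf.prob p (frozen \<gamma> p)"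
    using measure_pmf.prob_compl[of "frozen \<gamma> p" p] by (simp add: Compl_eq_Diff_UNIV)
  also have "measure_pmf.prob p (frozen \<gamma> p) = measure_pmf.prob p (frozen \<gamma> p \<inter> {..<d})"
    by (rule measure_pmf.finite_measure_eq_AE) (use p in \<open>auto simp: AE_measure_pmf_iff\<close>)
  also have "\<dots> = (\<Sum>j \<in> frozen \<gamma> p \<inter> {..<d}. pmf p j)"
    by (rule measure_measure_pmf_finite) simp
  finally show ?thesis
    unfolding play_distr_def by (simp add: pmf_cond[OF unfrozen])
qed

lemma pmf_play_distr_threshold:
  assumes "set_pmf p \<subseteq> {..<d}" "0 < \<epsilon>'" "\<epsilon>' < 4"
  defines "\<gamma> \<equiv> freeze_threshold d \<epsilon>'"
  shows "pmf (play_distr \<gamma> p) i =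
    (if i \<in> frozen \<gamma> p then 0
     else pmf p i / (1 - (\<Sum>j \<in> frozen \<gamma> p \<inter> {..<d}. pmf p j)))"
proof (rule pmf_play_distr[OF assms(1)], rule notI)
  assume "set_pmf p \<inter> - frozen \<gamma> p = {}"
  have d: "d > 0"
    using assms(1) set_pmf_not_empty[of p] by (cases d) auto
  have pos: "\<gamma> > 0"
    using d assms(2) by (simp add: \<gamma>_def freeze_threshold_def)
  have le: "pmf p i \<le> \<gamma>" for i
  proof (cases "i \<in> set_pmf p")
    case True
    then have "i \<in> frozen \<gamma> p"
      using \<open>set_pmf p \<inter> - frozen \<gamma> p = {}\<close> by blast
    then show ?thesis by (simp add: frozen_def)
  next
    case False
    then show ?thesis using pos by (simp add: set_pmf_iff)
  qed
  have "1 = (\<Sum>i<d. pmf p i)"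
    using assms(1) by (simp add: sum_pmf_eq_1)
  also have "\<dots> \<le> real d * \<gamma>"
    using sum_bounded_above[of "{..<d}" "pmf p" \<gamma>] le by simp
  also have "\<dots> = \<epsilon>' / 4"
    using d by (simp add: \<gamma>_def freeze_threshold_def)
  finally show False using assms(3) by simp
qed

end

theory Submission
  imports Defs
begin

text \<open>
  Surely, the loss of the full information algorithm on the estimates is
  $(1 - p(F)) \ell_I \ge (1 - \varepsilon/20)\, \ell_I$, as frozen arms carry mass at most
  $d \gamma = \varepsilon/20$. So only the estimated loss of the comparator needs concentration, and only
  from above. It lies in $[0, 1/\gamma]$ and has conditional mean at most $\ell_f$, so for
  $u = \varepsilon/5$ the exponential of $u \gamma \sum_t (\widetilde\ell_f - (1 + u) \ell_f)$ is a
  supermartingale. Markov's inequality costs $\ln(1/\eta_f) / (u \gamma)$. The union bound over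
  all comparators uses $\eta_f \propto \delta\, (dT)^{-K(f)} / d$, whose sum converges because
  $(1 + 1/T)^T \le e$; no decomposition of $f$ into segments is needed.
\<close>

section \<open>Weighted count of comparators by their number of shifts\<close>

lemma num_shifts_fun_upd_Suc:
  "num_shifts (Suc (Suc m)) (g(Suc m := y)) = num_shifts (Suc m) g + (if g m = y then 0 else 1)"
proof -
  have "{t. Suc t < Suc (Suc m) \<and> (g(Suc m := y)) t \<noteq> (g(Suc m := y)) (Suc t)} =
      {t. Suc t < Suc m \<and> g t \<noteq> g (Suc t)} \<union> (if g m = y then {} else {m})"
    by (auto simp: less_Suc_eq)
  moreover have "finite {t. Suc t < Suc m \<and> g t \<noteq> g (Suc t)}"
    by (rule finite_subset[of _ "{..m}"]) auto
  ultimately show ?thesis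
    by (auto simp: num_shifts_def card_insert_if)
qed

text \<open>Weight each shift by \<open>q\<close>. Among the continuations of a nonempty sequence,
  one repeats the last value and keeps the weight; fewer than \<open>d\<close> others each cost a
  factor \<open>q\<close>. So each further round multiplies the total by at most
  \<open>1 + d * q\<close>, and the free choice of the first value accounts for the factor
  \<open>d\<close>.\<close>

lemma sum_power_num_shifts_le:
  fixes q :: real
  assumes "0 \<le> q" "1 \<le> d"
  shows "(\<Sum>f\<in>{..<n} \<rightarrow>\<^sub>E {..<d}. q ^ num_shifts n f) \<le> real d * (1 + real d * q) ^ n"
proof (induction n)
  case 0
  then show ?case using assms by (simp add: num_shifts_def)
next
  case (Suc n)
  have eq: "(\<Sum>f\<in>{..<Suc n} \<rightarrow>\<^sub>E {..<d}. q ^ num_shifts (Suc n) f) =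
      (\<Sum>g\<in>{..<n} \<rightarrow>\<^sub>E {..<d}. \<Sum>y<d. q ^ num_shifts (Suc n) (g(n := y)))"
    unfolding lessThan_Suc PiE_insert_eq
    by (subst sum.reindex[OF inj_combinator])
       (simp_all add: sum.swap[of _ "{..<d}"] sum.cartesian_product case_prod_unfold)
  show ?case
  \<comment> \<open>The first value has no predecessor and creates no shift, so the one-step factor
    applies only from the second value on.\<close>
  proof (cases n)
    case 0
    then show ?thesis using assms unfolding eq by (simp add: num_shifts_def)
  next
    case (Suc m)
    have "(\<Sum>y<d. q ^ num_shifts (Suc n) (g(n := y))) \<le> q ^ num_shifts n g * (1 + real d * q)" for g
    proof -
      have "(\<Sum>y<d. q ^ num_shifts (Suc n) (g(n := y))) =
          q ^ num_shifts n g * (\<Sum>y<d. if g m = y then 1 else q)"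
        unfolding Suc num_shifts_fun_upd_Suc by (auto simp: sum_distrib_left intro!: sum.cong)
      also have "(\<Sum>y<d. if g m = y then 1 else q) \<le> (\<Sum>y<d. (if g m = y then 1 else 0) + q)"
        using assms by (intro sum_mono) auto
      also have "\<dots> \<le> 1 + real d * q"
        by (simp add: sum.distrib)
      finally show ?thesis using assms by (simp add: mult_left_mono)
    qed
    then have "(\<Sum>g\<in>{..<n} \<rightarrow>\<^sub>E {..<d}. \<Sum>y<d. q ^ num_shifts (Suc n) (g(n := y)))
        \<le> (\<Sum>g\<in>{..<n} \<rightarrow>\<^sub>E {..<d}. q ^ num_shifts n g) * (1 + real d * q)"
      unfolding sum_distrib_right by (rule sum_mono)
    also have "\<dots> \<le> real d * (1 + real d * q) ^ n * (1 + real d * q)"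
      using Suc.IH assms by (intro mult_right_mono) auto
    finally show ?thesis unfolding eq by (simp add: mult_ac)
  qed
qed

text \<open>Comparators are total functions on \<open>nat\<close>, hence infinitely many. Regret and
  shifts depend on the first \<open>T\<close> values only, so the union bound can run over a finite
  set of extensional functions.\<close>

lemma num_shifts_restrict: "num_shifts T (restrict f {..<T}) = num_shifts T f"
  unfolding num_shifts_def by (rule arg_cong[where f = card]) auto

lemma apx_reg_restrict: "apx_reg h T (restrict f {..<T}) \<epsilon> = apx_reg h T f \<epsilon>"
  by (simp add: apx_reg_def)

lemma shift_complexity_nonneg:
  assumes "d \<ge> 1" "T \<ge> 1"
  shows "shift_complexity d K T \<ge> 0"
proof -
  have "real d * real T \<ge> 1"
    using assms mult_mono[of 1 "real d" 1 "real T"] by simp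
  then show ?thesis using assms by (simp add: shift_complexity_def)
qed

section \<open>The played distribution and the runs of the algorithm\<close>

lemma frozen_prob_le:
  assumes "0 < \<epsilon>'" "d \<ge> 1"
  defines "\<gamma> \<equiv> freeze_threshold d \<epsilon>'"
  shows "(\<Sum>j \<in> frozen \<gamma> p \<inter> {..<d}. pmf p j) \<le> \<epsilon>' / 4"
proof -
  have \<gamma>: "\<gamma> > 0" using assms by (simp add: freeze_threshold_def)
  have "(\<Sum>j \<in> frozen \<gamma> p \<inter> {..<d}. pmf p j) \<le> real (card (frozen \<gamma> p \<inter> {..<d})) * \<gamma>"
    by (rule sum_bounded_above) (auto simp: frozen_def)
  also have "\<dots> \<le> real d * \<gamma>"
    using \<gamma> card_mono[of "{..<d}" "frozen \<gamma> p \<inter> {..<d}"] by (intro mult_right_mono) auto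
  finally show ?thesis using assms by (simp add: freeze_threshold_def)
qed

text \<open>Renormalising divides an unfrozen weight by \<open>1 - P\<close> with
  \<open>0 \<le> P \<le> \<epsilon>' / 4 < 1\<close>. This can only raise the weight above the
  threshold, and raises it by a factor of at most \<open>1 / (1 - \<epsilon>' / 4)\<close>.\<close>

lemma play_distr_ge_threshold:
  assumes p: "set_pmf p \<subseteq> {..<d}" and e: "0 < \<epsilon>'" "\<epsilon>' < 4" and d: "d \<ge> 1"
    and i: "i \<in> set_pmf (play_distr (freeze_threshold d \<epsilon>') p)"
  shows "freeze_threshold d \<epsilon>' \<le> pmf (play_distr (freeze_threshold d \<epsilon>') p) i"
    and "(1 - \<epsilon>' / 4) * pmf (play_distr (freeze_threshold d \<epsilon>') p) i \<le> pmf p i"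
    and "i < d"
proof -
  define \<gamma> where "\<gamma> = freeze_threshold d \<epsilon>'"
  define P where "P = (\<Sum>j \<in> frozen \<gamma> p \<inter> {..<d}. pmf p j)"
  define w where "w = pmf (play_distr \<gamma> p) i"
  have P: "P \<le> \<epsilon>' / 4" "0 \<le> P"
    using frozen_prob_le[OF e(1) d] by (simp_all add: P_def \<gamma>_def sum_nonneg)
  have w0: "w > 0" using i by (simp add: w_def \<gamma>_def set_pmf_iff pmf_pos)
  have "w = (if i \<in> frozen \<gamma> p then 0 else pmf p i / (1 - P))"
    unfolding w_def P_def \<gamma>_def by (rule pmf_play_distr_threshold[OF p e])
  with w0 have unfrozen: "i \<notin> frozen \<gamma> p" and w: "w = pmf p i / (1 - P)"
    by (auto split: if_splits)
  have "\<gamma> \<le> pmf p i" using unfrozen by (simp add: frozen_def)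
  also have pw: "pmf p i = (1 - P) * w" using w P e by simp
  also have "(1 - P) * w \<le> w" using P w0 by (simp add: mult_left_le_one_le)
  finally show "freeze_threshold d \<epsilon>' \<le> pmf (play_distr (freeze_threshold d \<epsilon>') p) i"
    by (simp add: w_def \<gamma>_def)
  show "(1 - \<epsilon>' / 4) * pmf (play_distr (freeze_threshold d \<epsilon>') p) i \<le> pmf p i"
    unfolding pw using P w0 by (auto simp: w_def \<gamma>_def intro!: mult_right_mono)
  have "pmf p i > 0" using pw P e w0 by simp
  then have "i \<in> set_pmf p" by (simp add: set_pmf_iff)
  then show "i < d" using p by auto
qed

text \<open>Turns the law of the run into facts about every single run of positive probability, so
  that the regret can be bounded pathwise. In round \<open>s\<close> the algorithm has seen exactly
  \<open>take s es\<close>.\<close>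

lemma double_threshold_freezing_support:
  assumes adv: "bandit_adversary d adv"
    and he: "(h, es) \<in> set_pmf (double_threshold_freezing A d \<epsilon>' adv t)"
  shows "length h = t \<and> length es = t \<and>
    (\<forall>s<t. fst (h ! s) \<in> loss_vecs d 1 \<and>
      snd (h ! s) \<in> set_pmf (play_distr (freeze_threshold d \<epsilon>') (A (take s es))) \<and>
      es ! s = loss_estimate (play_distr (freeze_threshold d \<epsilon>') (A (take s es)))
        (fst (h ! s)) (snd (h ! s)))"
  using he
proof (induction t arbitrary: h es)
  case 0
  then show ?case by simp
next
  case (Suc t)
  then obtain h' es' l I where
    he': "(h', es') \<in> set_pmf (double_threshold_freezing A d \<epsilon>' adv t)"
    and "l \<in> set_pmf (adv h')"
    and "I \<in> set_pmf (play_distr (freeze_threshold d \<epsilon>') (A es'))"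
    and "h = h' @ [(l, I)]"
    and "es = es' @ [loss_estimate (play_distr (freeze_threshold d \<epsilon>') (A es')) l I]"
    by (auto simp: Let_def)
  moreover have "l \<in> loss_vecs d 1"
    using adv \<open>l \<in> set_pmf (adv h')\<close> by (auto simp: bandit_adversary_def)
  ultimately show ?case
    using Suc.IH[OF he'] by (auto simp: less_Suc_eq nth_append)
qed

text \<open>Serves the degenerate cases: for \<open>\<epsilon> \<ge> 1\<close> the learner's term is
  not positive, and with a single arm learner and comparator agree.\<close>

lemma apx_reg_nonpos:
  assumes "\<And>t. t < T \<Longrightarrow> fst (h ! t) \<in> loss_vecs d 1"
    and "0 < \<epsilon>" and "1 \<le> \<epsilon> \<or> (\<forall>t<T. snd (h ! t) = f t)"
  shows "apx_reg h T f \<epsilon> \<le> 0"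
  unfolding apx_reg_def
proof (rule sum_nonpos)
  fix t assume t: "t \<in> {..<T}"
  have nn: "0 \<le> fst (h ! t) i" for i
    using assms(1)[of t] t by (cases "i < d") (auto simp: loss_vecs_def)
  show "(1 - \<epsilon>) * fst (h ! t) (snd (h ! t)) - fst (h ! t) (f t) \<le> 0"
  proof (cases "1 \<le> \<epsilon>")
    case True
    then show ?thesis using nn[of "snd (h ! t)"] nn[of "f t"]
      by (smt (verit) mult_nonpos_nonneg)
  next
    case False
    then show ?thesis using nn[of "f t"] assms t by (auto simp: left_diff_distrib)
  qed
qed

section \<open>Upper concentration of the comparator's estimated loss\<close>

text \<open>One step of the supermartingale. With \<open>x = pmf w i\<close>, the estimate is
  \<open>l i / x\<close> with probability \<open>x\<close> and 0 otherwise, so its exponential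
  moment is explicit.\<close>

lemma nn_integral_exp_loss_estimate_le:
  fixes w :: "nat pmf"
  assumes w: "i \<in> set_pmf w \<Longrightarrow> \<gamma> \<le> pmf w i" and \<gamma>: "0 < \<gamma>"
    and u: "0 \<le> u" "u \<le> 1" and l: "0 \<le> l i" "l i \<le> 1"
  shows "(\<integral>\<^sup>+I. ennreal (exp (u * \<gamma> * (loss_estimate w l I i - (1 + u) * l i))) \<partial>w) \<le> 1"
proof -
  define \<beta> :: real where "\<beta> = u * \<gamma>"
  have \<beta>: "0 \<le> \<beta>" using u \<gamma> by (simp add: \<beta>_def)
  define x where "x = pmf w i"
  define y where "y = \<beta> * (l i / x)"
  have x: "0 \<le> x" "x \<le> 1" by (simp_all add: x_def pmf_le_1)
  have bound: "x * exp y + (1 - x) \<le> exp (\<beta> * ((1 + u) * l i))"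
  \<comment> \<open>An arm outside the support, in particular a frozen one, has estimate 0 almost
    surely. This underestimates its loss, which is harmless for an upper bound.\<close>
  proof (cases "x = 0")
    case True
    then show ?thesis using \<beta> u l by simp
  next
    case False
    then have xg: "\<gamma> \<le> x" using w by (simp add: x_def set_pmf_iff)
    have x0: "0 < x" using \<gamma> xg by simp
    have y: "0 \<le> y" using \<beta> l x0 by (simp add: y_def)
    have "l i / x \<le> 1 / \<gamma>" using l xg \<gamma> by (intro frac_le) auto
    then have "y \<le> \<beta> * (1 / \<gamma>)" unfolding y_def using \<beta> by (rule mult_left_mono)
    then have yu: "y \<le> u" using \<gamma> by (simp add: \<beta>_def)
    \<comment> \<open>The scale \<gamma> keeps the exponent in \<open>[0, u]\<close>, so the
      quadratic bound on \<open>exp\<close> applies and its square term is absorbed into the factor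
      \<open>1 + u\<close>.\<close>
    have "exp y \<le> 1 + y + y\<^sup>2" using y yu u by (intro exp_bound) auto
    also have "y\<^sup>2 \<le> u * y" using y yu by (simp add: power2_eq_square mult_right_mono)
    finally have "x * exp y \<le> x * (1 + (1 + u) * y)"
      using x0 by (intro mult_left_mono) (auto simp: algebra_simps)
    also have "\<dots> = x + \<beta> * ((1 + u) * l i)" using x0 by (simp add: y_def field_simps)
    finally have "x * exp y + (1 - x) \<le> 1 + \<beta> * ((1 + u) * l i)" by simp
    also have "\<dots> \<le> exp (\<beta> * ((1 + u) * l i))" by (rule exp_ge_add_one_self)
    finally show ?thesis .
  qed
  define c where "c = exp (- (\<beta> * ((1 + u) * l i)))"
  have "(\<integral>\<^sup>+I. ennreal (exp (\<beta> * (loss_estimate w l I i - (1 + u) * l i))) \<partial>w) =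
      (\<integral>\<^sup>+I. ennreal (c * exp y) * indicator {i} I + ennreal c * indicator (- {i}) I \<partial>w)"
    by (intro nn_integral_cong)
       (auto simp: loss_estimate_def c_def x_def y_def right_diff_distrib exp_diff exp_minus exp_add
         field_simps indicator_def)
  also have "\<dots> = ennreal (c * exp y) * ennreal x + ennreal c * ennreal (1 - x)"
    using measure_pmf.prob_compl[of "{i}" w]
    by (simp add: nn_integral_add nn_integral_cmult measure_pmf.emeasure_eq_measure
        measure_pmf_single x_def Compl_eq_Diff_UNIV)
  also have "\<dots> = ennreal (c * (x * exp y + (1 - x)))"
    using x by (simp add: c_def ennreal_mult'[symmetric] ennreal_plus[symmetric] algebra_simps
        del: ennreal_plus)
  also have "\<dots> \<le> ennreal (c * exp (\<beta> * ((1 + u) * l i)))"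
    using bound by (intro ennreal_leI mult_left_mono) (simp_all add: c_def)
  also have "\<dots> = 1" by (simp add: c_def exp_minus)
  finally show ?thesis by (simp add: \<beta>_def)
qed

text \<open>Induction over the rounds: given the past, the arm is drawn independently of the new
  loss vector, so the one-step bound holds for each fixed choice of the adversary and survives
  averaging over it.\<close>

lemma nn_integral_exp_estimates_le:
  assumes A: "full_info_algorithm d A" and adv: "bandit_adversary d adv"
    and e: "0 < \<epsilon>'" "\<epsilon>' < 4" and d: "d \<ge> 1" and u: "0 \<le> u" "u \<le> 1"
  shows "(\<integral>\<^sup>+(h, es). ennreal (exp (u * freeze_threshold d \<epsilon>' *
      (\<Sum>s<t. (es ! s) (f s) - (1 + u) * fst (h ! s) (f s))))
      \<partial>double_threshold_freezing A d \<epsilon>' adv t) \<le> 1"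
proof (induction t)
  case 0
  then show ?case by simp
next
  case (Suc t)
  define \<gamma> where "\<gamma> = freeze_threshold d \<epsilon>'"
  have \<gamma>: "\<gamma> > 0" using e d by (simp add: \<gamma>_def freeze_threshold_def)
  define X where "X n h es = (\<Sum>s<n. (es ! s) (f s) - (1 + u) * fst (h ! s) (f s))"
    for n and h :: history and es :: "loss_vec list"
  let ?w = "\<lambda>es. play_distr \<gamma> (A es)"
  have step: "(\<integral>\<^sup>+l. \<integral>\<^sup>+I. ennreal (exp (u * \<gamma> *
        X (Suc t) (h @ [(l, I)]) (es @ [loss_estimate (?w es) l I]))) \<partial>?w es \<partial>adv h)
      \<le> ennreal (exp (u * \<gamma> * X t h es))"
    if he: "(h, es) \<in> set_pmf (double_threshold_freezing A d \<epsilon>' adv t)" for h es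
  proof -
    have len: "length h = t" "length es = t"
      using double_threshold_freezing_support[OF adv he] by simp_all
    have X: "X (Suc t) (h @ [(l, I)]) (es @ [e]) = X t h es + (e (f t) - (1 + u) * l (f t))" for l I e
      using len by (simp add: X_def nth_append)
    have *: "(\<integral>\<^sup>+I. ennreal (exp (u * \<gamma> *
        X (Suc t) (h @ [(l, I)]) (es @ [loss_estimate (?w es) l I]))) \<partial>?w es)
        \<le> ennreal (exp (u * \<gamma> * X t h es))" if "l \<in> set_pmf (adv h)" for l
    proof -
      have "l \<in> loss_vecs d 1" using adv that by (auto simp: bandit_adversary_def)
      \<comment> \<open>No range is assumed for \<open>f\<close>: outside the arms the loss is 0 by
        definition of \<open>loss_vecs\<close>.\<close>
      then have l: "0 \<le> l (f t)" "l (f t) \<le> 1"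
        by (cases "f t < d"; auto simp: loss_vecs_def)+
      have "set_pmf (A es) \<subseteq> {..<d}" using A by (simp add: full_info_algorithm_def)
      note w = play_distr_ge_threshold(1)[OF this e d, folded \<gamma>_def]
      have "(\<integral>\<^sup>+I. ennreal (exp (u * \<gamma> *
          X (Suc t) (h @ [(l, I)]) (es @ [loss_estimate (?w es) l I]))) \<partial>?w es) =
          ennreal (exp (u * \<gamma> * X t h es)) *
          (\<integral>\<^sup>+I. ennreal (exp (u * \<gamma> * (loss_estimate (?w es) l I (f t) - (1 + u) * l (f t)))) \<partial>?w es)"
        by (subst nn_integral_cmult[symmetric])
           (simp_all add: X distrib_left exp_add ennreal_mult)
      also have "\<dots> \<le> ennreal (exp (u * \<gamma> * X t h es)) * 1"
        by (intro mult_left_mono nn_integral_exp_loss_estimate_le w \<gamma> u l) simp_all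
      finally show ?thesis by simp
    qed
    have "(\<integral>\<^sup>+l. \<integral>\<^sup>+I. ennreal (exp (u * \<gamma> *
        X (Suc t) (h @ [(l, I)]) (es @ [loss_estimate (?w es) l I]))) \<partial>?w es \<partial>adv h)
        \<le> (\<integral>\<^sup>+l. ennreal (exp (u * \<gamma> * X t h es)) \<partial>adv h)"
      using * by (intro nn_integral_mono_AE) (simp add: AE_measure_pmf_iff)
    then show ?thesis by (simp add: measure_pmf.emeasure_space_1)
  qed
  have "(\<integral>\<^sup>+(h, es). ennreal (exp (u * \<gamma> * X (Suc t) h es))
        \<partial>double_threshold_freezing A d \<epsilon>' adv (Suc t)) =
      (\<integral>\<^sup>+(h, es). \<integral>\<^sup>+l. \<integral>\<^sup>+I. ennreal (exp (u * \<gamma> *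
        X (Suc t) (h @ [(l, I)]) (es @ [loss_estimate (?w es) l I]))) \<partial>?w es \<partial>adv h
        \<partial>double_threshold_freezing A d \<epsilon>' adv t)"
    by (simp add: case_prod_unfold Let_def \<gamma>_def)
  also have "\<dots> \<le> (\<integral>\<^sup>+(h, es). ennreal (exp (u * \<gamma> * X t h es))
        \<partial>double_threshold_freezing A d \<epsilon>' adv t)"
    using step by (intro nn_integral_mono_AE) (auto simp: AE_measure_pmf_iff)
  also have "\<dots> \<le> 1" using Suc by (simp add: X_def \<gamma>_def)
  finally show ?case by (simp add: X_def \<gamma>_def)
qed

text \<open>Markov's inequality for the exponential, with the level written as
  \<open>ln (1 / \<eta>)\<close> so that the failure probability is \<eta>.\<close>

lemma prob_estimates_large_le:
  assumes "full_info_algorithm d A" "bandit_adversary d adv"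
    and "0 < \<epsilon>'" "\<epsilon>' < 4" "d \<ge> 1" "0 \<le> u" "u \<le> 1" and \<eta>: "0 < \<eta>"
  shows "measure_pmf.prob (double_threshold_freezing A d \<epsilon>' adv t)
    {(h, es). ln (1 / \<eta>) \<le> u * freeze_threshold d \<epsilon>' *
      (\<Sum>s<t. (es ! s) (f s) - (1 + u) * fst (h ! s) (f s))} \<le> \<eta>"
proof -
  let ?M = "double_threshold_freezing A d \<epsilon>' adv t"
  let ?Y = "\<lambda>(h, es). u * freeze_threshold d \<epsilon>' *
      (\<Sum>s<t. (es ! s) (f s) - (1 + u) * fst (h ! s) (f s))"
  have "ln (1 / \<eta>) \<le> y \<longleftrightarrow> 1 \<le> ennreal \<eta> * ennreal (exp y)" for y
  proof -
    have "ln (1 / \<eta>) \<le> y \<longleftrightarrow> 1 / \<eta> \<le> exp y"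
      using \<eta> by (metis exp_le_cancel_iff exp_ln zero_less_divide_1_iff)
    also have "\<dots> \<longleftrightarrow> 1 \<le> \<eta> * exp y" using \<eta> by (simp add: field_simps)
    also have "\<dots> \<longleftrightarrow> 1 \<le> ennreal \<eta> * ennreal (exp y)"
      using \<eta> by (simp flip: ennreal_mult')
    finally show ?thesis .
  qed
  then have eq: "{(h, es). ln (1 / \<eta>) \<le> ?Y (h, es)} =
      {x \<in> UNIV. 1 \<le> ennreal \<eta> * ennreal (exp (?Y x))}"
    by auto
  have "emeasure ?M {(h, es). ln (1 / \<eta>) \<le> ?Y (h, es)} \<le>
      ennreal \<eta> * (\<integral>\<^sup>+x. ennreal (exp (?Y x)) * indicator UNIV x \<partial>?M)"
    unfolding eq by (rule nn_integral_Markov_inequality) simp_all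
  also have "\<dots> \<le> ennreal \<eta> * 1"
    using nn_integral_exp_estimates_le[OF assms(1-7), where f = f and t = t]
    by (intro mult_left_mono) (simp_all add: case_prod_unfold)
  finally show ?thesis using \<eta> by (simp add: measure_pmf.emeasure_eq_measure)
qed

section \<open>Pathwise regret bound from the full information guarantee\<close>

text \<open>Concerns one fixed run. The played loss is compared with the loss of \<open>A\<close> on
  the estimates, this with the comparator's estimated loss by the guarantee, and this with its true
  loss by \<open>conc\<close>.\<close>

lemma apx_reg_le:
  assumes A: "full_info_algorithm d A" and adv: "bandit_adversary d adv"
    and guar: "shifting_guarantee A d T (1 / freeze_threshold d (\<epsilon> / 5)) \<epsilon>"
    and \<epsilon>: "0 < \<epsilon>" "\<epsilon> < 1" and d: "d \<ge> 1" and T: "T \<ge> 1"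
    and he: "(h, es) \<in> set_pmf (double_threshold_freezing A d (\<epsilon> / 5) adv T)"
    and f: "f \<in> comparators d T"
    and conc: "\<epsilon> / 5 * freeze_threshold d (\<epsilon> / 5) *
      (\<Sum>s<T. (es ! s) (f s) - (1 + \<epsilon> / 5) * fst (h ! s) (f s)) \<le> c" and c: "0 \<le> c"
  shows "apx_reg h T f \<epsilon> \<le> 100 * (real d * (shift_complexity d (num_shifts T f) T + c) / \<epsilon>\<^sup>2)"
proof -
  define \<gamma> where "\<gamma> = freeze_threshold d (\<epsilon> / 5)"
  have \<gamma>_eq: "\<gamma> = \<epsilon> / (20 * real d)" by (simp add: \<gamma>_def freeze_threshold_def)
  have \<gamma>: "\<gamma> > 0" using \<epsilon> d by (simp add: \<gamma>_eq)
  define S where "S = shift_complexity d (num_shifts T f) T"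
  have S: "S \<ge> 0" using shift_complexity_nonneg[OF d T] by (simp add: S_def)
  define w where "w s = play_distr \<gamma> (A (take s es))" for s
  define g where "g s = fst (h ! s) (snd (h ! s))" for s
  have len: "length es = T"
    and l: "\<And>s. s < T \<Longrightarrow> fst (h ! s) \<in> loss_vecs d 1"
    and I: "\<And>s. s < T \<Longrightarrow> snd (h ! s) \<in> set_pmf (w s)"
    and es: "\<And>s. s < T \<Longrightarrow> es ! s = loss_estimate (w s) (fst (h ! s)) (snd (h ! s))"
    using double_threshold_freezing_support[OF adv he] by (simp_all add: w_def \<gamma>_def)
  have sup: "set_pmf (A ls) \<subseteq> {..<d}" for ls using A by (simp add: full_info_algorithm_def)
  have e5: "0 < \<epsilon> / 5" "\<epsilon> / 5 < 4" using \<epsilon> by simp_all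
  note pd = play_distr_ge_threshold[OF sup e5 d, folded \<gamma>_def]
  have arm: "snd (h ! s) < d" if "s < T" for s
    using pd(3) I[OF that] by (simp add: w_def)
  have wge: "\<gamma> \<le> pmf (w s) (snd (h ! s))" if "s < T" for s
    using pd(1) I[OF that] by (simp add: w_def)
  have g: "0 \<le> g s" "g s \<le> 1" if "s < T" for s
    using l[OF that] arm[OF that] by (auto simp: loss_vecs_def g_def)
  have "es ! s \<in> loss_vecs d (1 / \<gamma>)" if s: "s < T" for s
  proof -
    have "g s / pmf (w s) (snd (h ! s)) \<le> 1 / \<gamma>"
      using g[OF s] wge[OF s] \<gamma> by (intro frac_le) auto
    moreover have "0 \<le> g s / pmf (w s) (snd (h ! s))" using g[OF s] by simp
    ultimately show ?thesis
      using \<gamma> arm[OF s] by (auto simp: loss_vecs_def es[OF s] loss_estimate_def g_def)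
  qed
  then have "set es \<subseteq> loss_vecs d (1 / \<gamma>)" using len by (auto simp: in_set_conv_nth)
  with guar len f have G: "expected_apx_reg A d T es f (\<epsilon> / 5) \<le> 5 * (1 / \<gamma>) * S / \<epsilon>"
    unfolding shifting_guarantee_def \<gamma>_def S_def by blast
  \<comment> \<open>Only the drawn arm can have a nonzero estimate, so \<open>A\<close> incurs the
    played loss times the ratio of the weights under \<open>A\<close> and \<open>w\<close>, which is
    at least \<open>1 - (\<epsilon> / 5) / 4\<close>.\<close>
  have played: "(1 - \<epsilon> / 20) * g s \<le> (\<Sum>i<d. pmf (A (take s es)) i * (es ! s) i)" if s: "s < T" for s
  proof -
    let ?I = "snd (h ! s)"
    have wpos: "0 < pmf (w s) ?I" using wge[OF s] \<gamma> by simp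
    have "(\<Sum>i<d. pmf (A (take s es)) i * (es ! s) i) =
        (\<Sum>i<d. if i = ?I then pmf (A (take s es)) ?I * (g s / pmf (w s) ?I) else 0)"
      by (intro sum.cong) (auto simp: es[OF s] loss_estimate_def g_def)
    also have "\<dots> = pmf (A (take s es)) ?I * (g s / pmf (w s) ?I)"
      using arm[OF s] by simp
    also have "\<dots> \<ge> (1 - \<epsilon> / 5 / 4) * pmf (w s) ?I * (g s / pmf (w s) ?I)"
      using pd(2) I[OF s] g[OF s] by (intro mult_right_mono) (auto simp: w_def)
    finally show ?thesis using wpos by simp
  qed
  define G1 where "G1 = (\<Sum>s<T. g s)"
  define E where "E = (\<Sum>s<T. (es ! s) (f s))"
  define F where "F = (\<Sum>s<T. fst (h ! s) (f s))"
  have G1: "0 \<le> G1" using g unfolding G1_def by (intro sum_nonneg) simp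
  have "(1 - \<epsilon> / 5) * ((1 - \<epsilon> / 20) * G1) - E \<le> expected_apx_reg A d T es f (\<epsilon> / 5)"
    unfolding expected_apx_reg_def sum_subtractf E_def G1_def sum_distrib_left[symmetric]
    using played \<epsilon>
    by (intro diff_mono mult_left_mono order.refl) (auto simp: sum_distrib_left intro!: sum_mono)
  with G have 1: "(1 - \<epsilon> / 5) * ((1 - \<epsilon> / 20) * G1) - E \<le> 5 * (1 / \<gamma>) * S / \<epsilon>" by simp
  have "\<epsilon> / 5 * \<gamma> * (E - (1 + \<epsilon> / 5) * F) \<le> c"
    using conc by (simp add: \<gamma>_def E_def F_def sum_subtractf sum_distrib_left)
  then have 2: "E - (1 + \<epsilon> / 5) * F \<le> c / (\<epsilon> / 5 * \<gamma>)"
    using \<epsilon> \<gamma> by (simp add: pos_le_divide_eq mult.commute)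
  define R where "R = 100 * (real d * (S + c) / \<epsilon>\<^sup>2)"
  have R: "R \<ge> 0" using S c by (simp add: R_def)
  \<comment> \<open>Guarantee and confidence term share the factor
    \<open>5 / (\<epsilon> * \<gamma>)\<close>, which is
    \<open>100 * d / \<epsilon>\<^sup>2\<close>.\<close>
  have "5 * (1 / \<gamma>) * S / \<epsilon> + c / (\<epsilon> / 5 * \<gamma>) = R"
    using \<epsilon> d by (simp add: R_def \<gamma>_eq field_simps power2_eq_square)
  with 1 2 have 3: "(1 - \<epsilon> / 5) * ((1 - \<epsilon> / 20) * G1) \<le> (1 + \<epsilon> / 5) * F + R" by linarith
  \<comment> \<open>All multiplicative losses together fit into the discount
    \<open>1 - \<epsilon>\<close>. Enlarging \<open>R\<close> by \<open>1 + \<epsilon> / 5\<close>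
    afterwards lets this factor cancel.\<close>
  have "(1 + \<epsilon> / 5) * (1 - \<epsilon>) \<le> (1 - \<epsilon> / 5) * (1 - \<epsilon> / 20)"
  proof -
    have "(1 - \<epsilon> / 5) * (1 - \<epsilon> / 20) - (1 + \<epsilon> / 5) * (1 - \<epsilon>) = 11 / 20 * \<epsilon> + 21 / 100 * \<epsilon>\<^sup>2"
      by (simp add: field_simps power2_eq_square)
    also have "\<dots> \<ge> 0" using \<epsilon> by simp
    finally show ?thesis by simp
  qed
  then have "(1 + \<epsilon> / 5) * (1 - \<epsilon>) * G1 \<le> (1 - \<epsilon> / 5) * (1 - \<epsilon> / 20) * G1"
    using G1 by (rule mult_right_mono)
  also have "\<dots> \<le> (1 + \<epsilon> / 5) * F + (1 + \<epsilon> / 5) * R"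
    using 3 mult_right_mono[of 1 "1 + \<epsilon> / 5" R] R \<epsilon> by (simp add: mult.assoc)
  finally have "(1 + \<epsilon> / 5) * ((1 - \<epsilon>) * G1) \<le> (1 + \<epsilon> / 5) * (F + R)"
    by (simp add: distrib_left[of _ F R] mult.assoc)
  then have "(1 - \<epsilon>) * G1 \<le> F + R" using \<epsilon> by simp
  then show ?thesis
    by (simp add: apx_reg_def sum_subtractf sum_distrib_left[symmetric] G1_def F_def g_def R_def S_def)
qed

section \<open>Union bound over all comparators\<close>

theorem theorem5p6:
  shows "\<exists>C::real. C > 0 \<and>
    (\<forall>(d::nat) (T::nat) (\<epsilon>::real) (A::full_info_alg) (adv::adversary) (\<delta>::real).
       d \<ge> 1 \<longrightarrow> T \<ge> 1 \<longrightarrow> \<epsilon> > 0 \<longrightarrow> \<delta> > 0 \<longrightarrow>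
       full_info_algorithm d A \<longrightarrow>
       shifting_guarantee A d T (1 / freeze_threshold d (\<epsilon> / 5)) \<epsilon> \<longrightarrow>
       bandit_adversary d adv \<longrightarrow>
       measure_pmf.prob (double_threshold_freezing A d (\<epsilon> / 5) adv T)
         {(h, es). \<forall>f \<in> comparators d T.
            apx_reg h T f \<epsilon>
              \<le> C * (real d *
                    (shift_complexity d (num_shifts T f) T
                     + (if num_shifts T f = 0 then ln (1 / \<delta>)
                        else real (num_shifts T f) * ln (real d * real T / \<delta>)))
                    / \<epsilon>\<^sup>2)}
         \<ge> 1 - \<delta>)"
\<comment> \<open>The constant is 100 from \<open>apx_reg_le\<close> times 3 from
  \<open>ln_\<eta>\<close>, which compares \<open>ln (1 / \<eta> f)\<close> with the terms of the
  final bound.\<close>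
proof (intro exI[of _ 300] conjI allI impI)
  fix d T :: nat and \<epsilon> \<delta> :: real and A :: full_info_alg and adv :: adversary
  assume d: "d \<ge> 1" and T: "T \<ge> 1" and \<epsilon>: "\<epsilon> > 0" and \<delta>: "\<delta> > 0"
    and A: "full_info_algorithm d A"
    and guar: "shifting_guarantee A d T (1 / freeze_threshold d (\<epsilon> / 5)) \<epsilon>"
    and adv: "bandit_adversary d adv"
  define M where "M = double_threshold_freezing A d (\<epsilon> / 5) adv T"
  define conf where "conf K = (if K = 0 then ln (1 / \<delta>) else real K * ln (real d * real T / \<delta>))" for K
  define B where "B K = 300 * (real d * (shift_complexity d K T + conf K) / \<epsilon>\<^sup>2)" for K
  define Good where "Good = {(h, es :: loss_vec list). \<forall>f \<in> comparators d T. apx_reg h T f \<epsilon> \<le> B (num_shifts T f)}"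
  have dT: "real d * real T \<ge> 1"
    using d T mult_mono[of 1 "real d" 1 "real T"] by simp
  have "measure_pmf.prob M Good \<ge> 1 - \<delta>"
  proof (cases "\<delta> \<ge> 1")
    case True
    then show ?thesis by (smt (verit) measure_nonneg)
  next
    case False
    then have \<delta>1: "\<delta> < 1" by simp
    have ln\<delta>: "0 \<le> ln (1 / \<delta>)" using \<delta> \<delta>1 by simp
    \<comment> \<open>For every number of shifts the confidence term pays for one
      \<open>ln (1 / \<delta>)\<close>; with shifts present this uses
      \<open>d * T \<ge> 1\<close>.\<close>
    have conf: "ln (1 / \<delta>) \<le> conf K" for K
    proof (cases "K = 0")
      case False
      have "1 / \<delta> \<le> real d * real T / \<delta>" using dT \<delta> by (simp add: divide_right_mono)
      then have "ln (1 / \<delta>) \<le> ln (real d * real T / \<delta>)" using \<delta> by (subst ln_le_cancel_iff) (use dT in auto)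
      moreover have "ln (real d * real T / \<delta>) \<le> real K * ln (real d * real T / \<delta>)"
        using False ln\<delta> calculation by (intro mult_right_mono[of 1 "real K", simplified]) auto
      ultimately show ?thesis using False by (simp add: conf_def)
    qed (simp add: conf_def)
    have B: "0 \<le> B K" for K
      using shift_complexity_nonneg[OF d T, of K] conf[of K] ln\<delta> by (simp add: B_def)
    show ?thesis
    proof (cases "\<epsilon> \<ge> 1 \<or> d = 1")
      \<comment> \<open>For \<open>\<epsilon> \<ge> 20\<close> every arm may be frozen, and \<open>play_distr\<close> is then unspecified; for \<open>d = 1\<close>
        there is no \<open>ln d\<close> to absorb the additive constant of \<open>ln (1 / \<eta> f)\<close>.\<close>
      case True
      have "x \<in> Good" if "x \<in> set_pmf M" for x
      proof (cases x)
        case (Pair h es)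
        have sup: "set_pmf (A ls) \<subseteq> {..<d}" for ls using A by (simp add: full_info_algorithm_def)
        have "apx_reg h T f \<epsilon> \<le> 0" if f: "f \<in> comparators d T" for f
        proof (rule apx_reg_nonpos)
          note supp = double_threshold_freezing_support[OF adv, of h es A "\<epsilon> / 5" T]
          show "fst (h ! t) \<in> loss_vecs d 1" if "t < T" for t
            using supp \<open>x \<in> set_pmf M\<close> Pair that by (auto simp: M_def)
          show "1 \<le> \<epsilon> \<or> (\<forall>t<T. snd (h ! t) = f t)"
          proof (subst disj_commute, rule disjCI, intro allI impI)
            fix t assume "\<not> (1 \<le> \<epsilon>)" and t: "t < T"
            with True have "d = 1" by simp
            moreover have "snd (h ! t) < d"
              using play_distr_ge_threshold(3)[OF sup, of "\<epsilon> / 5"] supp t \<open>x \<in> set_pmf M\<close> Pair \<epsilon> d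
                \<open>\<not> (1 \<le> \<epsilon>)\<close> by (auto simp: M_def)
            ultimately show "snd (h ! t) = f t" using f t by (simp add: comparators_def)
          qed
        qed (rule \<epsilon>)
        then show ?thesis using B Pair order_trans by (fastforce simp: Good_def)
      qed
      then have "measure_pmf.prob M Good = 1"
        by (simp add: measure_pmf.prob_eq_1 AE_measure_pmf_iff)
      then show ?thesis using \<delta> by simp
    next
      case False
      then have \<epsilon>1: "\<epsilon> < 1" and d2: "d \<ge> 2" using d by auto
      \<comment> \<open>With this \<open>q\<close> the factor per round is \<open>1 + 1 / T\<close>,
        so the weights sum to at most \<open>d * exp 1\<close>; the normalisation in \<eta> brings
        the total to at most \<delta>.\<close>
      define q where "q = 1 / (real d * real T)"
      have q: "0 < q" using d T by (simp add: q_def)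
      define \<eta> where "\<eta> f = \<delta> / (exp 1 * real d) * q ^ num_shifts T f" for f
      have \<eta>: "0 < \<eta> f" for f using \<delta> d q by (simp add: \<eta>_def)
      define \<Omega> where "\<Omega> = {..<T} \<rightarrow>\<^sub>E {..<d}"
      have fin: "finite \<Omega>" by (simp add: \<Omega>_def finite_PiE)
      have "(\<Sum>f\<in>\<Omega>. \<eta> f) \<le> \<delta> / (exp 1 * real d) * (real d * (1 + real d * q) ^ T)"
        unfolding \<eta>_def \<Omega>_def sum_distrib_left[symmetric]
        using \<delta> q d by (intro mult_left_mono sum_power_num_shifts_le) auto
      also have "\<dots> \<le> \<delta> / (exp 1 * real d) * (real d * exp 1)"
      proof -
        have "(1 + real d * q) ^ T \<le> exp (1 / real T) ^ T"
          using d exp_ge_add_one_self[of "1 / real T"] by (intro power_mono) (auto simp: q_def)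
        also have "\<dots> = exp 1" using T by (simp flip: exp_of_nat_mult)
        finally show ?thesis using \<delta> by (intro mult_left_mono) auto
      qed
      also have "\<dots> = \<delta>" using d by simp
      finally have sum_\<eta>: "(\<Sum>f\<in>\<Omega>. \<eta> f) \<le> \<delta>" .
      \<comment> \<open>Here \<open>ln (1 / \<eta> f)\<close> is
        \<open>ln (1 / \<delta>) + 1 + ln d + a\<close>, while the shift complexity is
        \<open>a + 2 * ln d\<close>. The 1, which comes from \<open>exp 1\<close> in \<eta>, is at
        most \<open>2 * ln d\<close> as \<open>d \<ge> 2\<close>.\<close>
      have ln_\<eta>: "0 \<le> ln (1 / \<eta> f)"
        "shift_complexity d (num_shifts T f) T + ln (1 / \<eta> f)
          \<le> 3 * (shift_complexity d (num_shifts T f) T + conf (num_shifts T f))" for f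
      proof -
        define K where "K = num_shifts T f"
        define a where "a = real K * ln (real d * real T)"
        have lnq: "ln q = - ln (real d * real T)" using d T by (simp add: q_def ln_div)
        have eq: "ln (1 / \<eta> f) = ln (1 / \<delta>) + 1 + ln (real d) + a"
          using \<delta> d q lnq unfolding \<eta>_def a_def K_def[symmetric]
          by (simp add: ln_div ln_mult ln_realpow)
        have a: "0 \<le> a" using dT by (simp add: a_def)
        have "1 \<le> 2 * ln (2 :: real)" using ln2_ge_two_thirds by simp
        also have "\<dots> \<le> 2 * ln (real d)" using d2 by simp
        finally have ln_d: "1 \<le> 2 * ln (real d)" .
        show "0 \<le> ln (1 / \<eta> f)" using eq ln\<delta> a ln_d by linarith
        show "shift_complexity d (num_shifts T f) T + ln (1 / \<eta> f)
          \<le> 3 * (shift_complexity d (num_shifts T f) T + conf (num_shifts T f))"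
          unfolding eq shift_complexity_def K_def[symmetric] a_def[symmetric]
          using conf[of K] ln\<delta> a ln_d by (simp add: algebra_simps)
      qed
      define Bad where "Bad f = {(h :: history, es :: loss_vec list). ln (1 / \<eta> f) \<le>
          \<epsilon> / 5 * freeze_threshold d (\<epsilon> / 5) *
          (\<Sum>s<T. (es ! s) (f s) - (1 + \<epsilon> / 5) * fst (h ! s) (f s))}" for f
      have "measure_pmf.prob M (\<Union>f\<in>\<Omega>. Bad f) \<le> (\<Sum>f\<in>\<Omega>. measure_pmf.prob M (Bad f))"
        using fin by (intro measure_pmf.finite_measure_subadditive_finite) auto
      also have "\<dots> \<le> (\<Sum>f\<in>\<Omega>. \<eta> f)"
        unfolding Bad_def M_def using \<epsilon> \<epsilon>1
        by (intro sum_mono prob_estimates_large_le A adv d \<eta>) auto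
      finally have bad: "measure_pmf.prob M (\<Union>f\<in>\<Omega>. Bad f) \<le> \<delta>" using sum_\<eta> by simp
      have "x \<in> Good" if x: "x \<in> set_pmf M" "x \<notin> (\<Union>f\<in>\<Omega>. Bad f)" for x
      proof (cases x)
        case (Pair h es)
        have "apx_reg h T f \<epsilon> \<le> B (num_shifts T f)" if f: "f \<in> comparators d T" for f
        proof -
          \<comment> \<open>The bad events are indexed by restrictions to the first \<open>T\<close>
            rounds, which change neither regret nor shifts.\<close>
          define f' where "f' = restrict f {..<T}"
          have f': "f' \<in> \<Omega>" "f' \<in> comparators d T"
            using f by (auto simp: f'_def \<Omega>_def comparators_def)
          have "x \<notin> Bad f'" using x f' by blast
          then have "apx_reg h T f' \<epsilon> \<le>
              100 * (real d * (shift_complexity d (num_shifts T f') T + ln (1 / \<eta> f')) / \<epsilon>\<^sup>2)"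
            using x Pair ln_\<eta>(1)
            by (intro apx_reg_le[OF A adv guar \<epsilon> \<epsilon>1 d T _ f'(2), of h es]) (auto simp: M_def Bad_def)
          also have "\<dots> \<le> 100 * (real d *
              (3 * (shift_complexity d (num_shifts T f') T + conf (num_shifts T f'))) / \<epsilon>\<^sup>2)"
            by (intro mult_left_mono divide_right_mono ln_\<eta>(2)) auto
          also have "\<dots> = B (num_shifts T f')" by (simp add: B_def)
          finally show ?thesis by (simp add: f'_def apx_reg_restrict num_shifts_restrict)
        qed
        then show ?thesis by (simp add: Good_def Pair)
      qed
      \<comment> \<open>The inclusion is established on the support of \<open>M\<close> only, hence
        the almost everywhere form of monotonicity.\<close>
      then have "measure_pmf.prob M (- Good) \<le> measure_pmf.prob M (\<Union>f\<in>\<Omega>. Bad f)"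
        by (intro measure_pmf.finite_measure_mono_AE) (auto simp: AE_measure_pmf_iff)
      with bad show ?thesis
        using measure_pmf.prob_compl[of Good M] by (simp add: Compl_eq_Diff_UNIV)
    qed
  qed
  then show "measure_pmf.prob (double_threshold_freezing A d (\<epsilon> / 5) adv T)
         {(h, es). \<forall>f \<in> comparators d T.
            apx_reg h T f \<epsilon>
              \<le> 300 * (real d *
                    (shift_complexity d (num_shifts T f) T
                     + (if num_shifts T f = 0 then ln (1 / \<delta>)
                        else real (num_shifts T f) * ln (real d * real T / \<delta>)))
                    / \<epsilon>\<^sup>2)}
         \<ge> 1 - \<delta>"
    by (simp add: Good_def M_def B_def conf_def)
qed simp

end
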